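(* Let $\Gamma$ be a discrete group acting freely, properly, and cocompactly on $\mathbb{R}^n$. Then the algebra of polynomial invariants is trivial, i.e. $P(\mathbb{R}^n)^\Gamma=\mathbb{R}$: every real polynomial function $p$ on $\mathbb{R}^n$ satisfying $p(\gamma\cdot x)=p(x)$ for all $\gamma\in\Gamma$ and $x\in\mathbb{R}^n$ is constant.
   Context: The action is a continuous action, not assumed to be linear. A discrete group $\Gamma$ acts cocompactly on $\mathbb{R}^n$ if the quotient space $\mathbb{R}^n/\Gamma$ is compact. The action is proper if the map $\Gamma\times\mathbb{R}^n\to\mathbb{R}^n\times\mathbb{R}^n$, $(\gamma,x)\mapsto(\gamma\cdot x,x)$, is proper ($\Gamma$ having the discrete topology). $P(\mathbb{R}^n)^\Gamma$ denotes the algebra of real polynomial functions on $\mathbb{R}^n$ that are $\Gamma$-invariant. *)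

theory Defs
  imports "HOL-Analysis.Analysis" "HOL-Algebra.Group_Action"
begin

text \<open>
  The acting group is given without topology; wherever one is needed, its carrier is taken with
  the discrete topology. Since \<^const>\<open>proper_map\<close> does not include continuity, continuity of the
  action is a separate requirement.
\<close>

definition continuous_action ::
    "('g, 'm) monoid_scheme \<Rightarrow> 'a topology \<Rightarrow> ('g \<Rightarrow> 'a \<Rightarrow> 'a) \<Rightarrow> bool" where
  "continuous_action G X \<phi> \<longleftrightarrow>
     group_action G (topspace X) \<phi> \<and>
     continuous_map (prod_topology (discrete_topology (carrier G)) X) X (\<lambda>(g, x). \<phi> g x)"

definition free_action ::
    "('g, 'm) monoid_scheme \<Rightarrow> 'a topology \<Rightarrow> ('g \<Rightarrow> 'a \<Rightarrow> 'a) \<Rightarrow> bool" where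
  "free_action G X \<phi> \<longleftrightarrow> (\<forall>x \<in> topspace X. stabilizer G \<phi> x = {\<one>\<^bsub>G\<^esub>})"

definition proper_action ::
    "('g, 'm) monoid_scheme \<Rightarrow> 'a topology \<Rightarrow> ('g \<Rightarrow> 'a \<Rightarrow> 'a) \<Rightarrow> bool" where
  "proper_action G X \<phi> \<longleftrightarrow>
     proper_map (prod_topology (discrete_topology (carrier G)) X) (prod_topology X X)
       (\<lambda>(g, x). (\<phi> g x, x))"

definition orbit_space ::
    "('g, 'm) monoid_scheme \<Rightarrow> 'a topology \<Rightarrow> ('g \<Rightarrow> 'a \<Rightarrow> 'a) \<Rightarrow> 'a set topology" where
  "orbit_space G X \<phi> =
     topology (\<lambda>U. U \<subseteq> orbits G (topspace X) \<phi> \<and> openin X {x \<in> topspace X. orbit G \<phi> x \<in> U})"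

definition cocompact_action ::
    "('g, 'm) monoid_scheme \<Rightarrow> 'a topology \<Rightarrow> ('g \<Rightarrow> 'a \<Rightarrow> 'a) \<Rightarrow> bool" where
  "cocompact_action G X \<phi> \<longleftrightarrow> compact_space (orbit_space G X \<phi>)"

definition polynomial_invariants ::
    "('g, 'm) monoid_scheme \<Rightarrow> ('g \<Rightarrow> 'a \<Rightarrow> 'a) \<Rightarrow> ('a::euclidean_space \<Rightarrow> real) set" where
  "polynomial_invariants G \<phi> =
     {p. real_polynomial_function p \<and> (\<forall>g \<in> carrier G. \<forall>x. p (\<phi> g x) = p x)}"

lemma openin_orbit_space:
  "openin (orbit_space G X \<phi>) U \<longleftrightarrow>
     U \<subseteq> orbits G (topspace X) \<phi> \<and> openin X {x \<in> topspace X. orbit G \<phi> x \<in> U}"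
proof -
  let ?L = "\<lambda>U. U \<subseteq> orbits G (topspace X) \<phi> \<and> openin X {x \<in> topspace X. orbit G \<phi> x \<in> U}"
  have "istopology ?L"
    unfolding istopology_def
  proof (intro conjI allI impI)
    fix S T assume "?L S" "?L T"
    moreover have "{x \<in> topspace X. orbit G \<phi> x \<in> S \<inter> T} =
        {x \<in> topspace X. orbit G \<phi> x \<in> S} \<inter> {x \<in> topspace X. orbit G \<phi> x \<in> T}" by auto
    ultimately show "S \<inter> T \<subseteq> orbits G (topspace X) \<phi>"
      "openin X {x \<in> topspace X. orbit G \<phi> x \<in> S \<inter> T}" by auto
  next
    fix K assume K: "\<forall>S\<in>K. ?L S"
    then show "\<Union>K \<subseteq> orbits G (topspace X) \<phi>" by blast
    have "{x \<in> topspace X. orbit G \<phi> x \<in> \<Union>K} =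
        (\<Union>S\<in>K. {x \<in> topspace X. orbit G \<phi> x \<in> S})" by auto
    with K show "openin X {x \<in> topspace X. orbit G \<phi> x \<in> \<Union>K}" by auto
  qed
  then show ?thesis
    by (simp add: orbit_space_def)
qed

lemma topspace_orbit_space: "topspace (orbit_space G X \<phi>) = orbits G (topspace X) \<phi>"
proof -
  have "{x \<in> topspace X. orbit G \<phi> x \<in> orbits G (topspace X) \<phi>} = topspace X"
    by (auto simp: orbits_def)
  then have "openin (orbit_space G X \<phi>) (orbits G (topspace X) \<phi>)"
    by (simp add: openin_orbit_space)
  then show ?thesis
    by (meson openin_orbit_space openin_subset openin_topspace subset_antisym)
qed

lemma quotient_map_orbit_space: "quotient_map X (orbit_space G X \<phi>) (orbit G \<phi>)"
  by (auto simp: quotient_map_def topspace_orbit_space openin_orbit_space orbits_def)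

end

theory Submission
  imports Defs
begin

text \<open>Invariance makes p constant on orbits, so p factors through a continuous function on the
  compact orbit space and has compact, hence bounded, range
  (\<open>compactin_image_invariant\<close>). On the line through 0 and x, p becomes a bounded
  polynomial in one real variable; such a polynomial has no nonconstant terms, so p agrees at x and
  0 (\<open>bounded_real_polynomial_function_constant\<close>).\<close>

text \<open>
  An invariant polynomial descends to a continuous function on the compact orbit space, so it is
  bounded; a bounded polynomial is constant along every line through the origin.
\<close>

lemma bounded_real_polynomial_function_constant:
  fixes p :: "'a::euclidean_space \<Rightarrow> real"
  assumes p: "real_polynomial_function p" and b: "bounded (range p)"
  shows "p x = p 0"
proof -
  have "real_polynomial_function (p \<circ> (\<lambda>t::real. t *\<^sub>R x))"
    by (intro real_polynomial_function_compose[OF _ p] polynomial_function_bounded_linear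
        bounded_linear_scaleR_left)
  then obtain a n where a: "p \<circ> (\<lambda>t. t *\<^sub>R x) = (\<lambda>t. \<Sum>i\<le>n. a i * t ^ i)"
    using real_polynomial_function_imp_sum by blast
  obtain B where B: "\<And>y. norm (p y) \<le> B"
    using b by (auto simp: bounded_iff)
  have val: "p (t *\<^sub>R x) = (\<Sum>i\<le>n. a i * t ^ i)" for t
    using fun_cong[OF a, of t] by simp
  \<comment> \<open>A nonzero coefficient of positive degree would force the absolute value to
    infinity along the line; \<open>B + 1\<close> is a level that the bound \<open>B\<close> rules
    out.\<close>
  have "a k = 0" if "k \<noteq> 0" "k \<le> n" for k
  proof (rule ccontr)
    assume "a k \<noteq> 0"
    then have "eventually (\<lambda>t. norm (\<Sum>i\<le>n. a i * t ^ i) \<ge> B + 1) at_infinity"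
      using polyfun_extremal[of n a "B + 1"] that by blast
    then obtain t where "norm (\<Sum>i\<le>n. a i * t ^ i) \<ge> B + 1"
      using eventually_happens[of _ at_infinity] trivial_limit_at_infinity by auto
    with B[of "t *\<^sub>R x"] val show False by simp
  qed
  \<comment> \<open>The parameters 1 and 0 give the points x and 0. Only the terms with i = 0
    survive, and they agree because \<open>0 ^ 0 = 1\<close>.\<close>
  then have "(\<Sum>i\<le>n. a i * 1 ^ i) = (\<Sum>i\<le>n. a i * 0 ^ i)"
    by (intro sum.cong) (auto simp: power_0_left)
  with val[of 1] val[of 0] show ?thesis by simp
qed

text \<open>The fibres of the quotient map \<open>orbit G \<phi>\<close> are the orbits, so f
  descends to a continuous map on the compact orbit space with the same image as f.\<close>

lemma compactin_image_invariant:
  assumes act: "group_action G (topspace X) \<phi>"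
    and cocompact: "cocompact_action G X \<phi>"
    and f: "continuous_map X Y f"
    and inv: "\<And>g x. g \<in> carrier G \<Longrightarrow> x \<in> topspace X \<Longrightarrow> f (\<phi> g x) = f x"
  shows "compactin Y (f ` topspace X)"
proof -
  interpret group_action G "topspace X" \<phi> by (rule act)
  have "f x = f y" if "x \<in> topspace X" "y \<in> topspace X" "orbit G \<phi> x = orbit G \<phi> y" for x y
  proof -
    \<comment> \<open>Since y lies in its own orbit, which is also that of x, some group element
      carries x to y.\<close>
    have "y \<in> orbit G \<phi> x" using that orbit_refl by blast
    then show ?thesis using that inv by (auto simp: orbit_def)
  qed
  then obtain h where h: "continuous_map (orbit_space G X \<phi>) Y h"
      "h ` topspace (orbit_space G X \<phi>) = f ` topspace X"
    using quotient_map_lift_exists[OF quotient_map_orbit_space f] by metis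
  then show ?thesis
    using cocompact image_compactin unfolding cocompact_action_def compact_space_def by metis
qed

theorem theoremB:
  fixes \<Gamma> :: "('g, 'm) monoid_scheme"
    and \<phi> :: "'g \<Rightarrow> real ^ 'n \<Rightarrow> real ^ 'n"
  assumes "continuous_action \<Gamma> euclidean \<phi>"
    and "free_action \<Gamma> euclidean \<phi>"
    and "proper_action \<Gamma> euclidean \<phi>"
    and "cocompact_action \<Gamma> euclidean \<phi>"
  shows "polynomial_invariants \<Gamma> \<phi> = range (\<lambda>(c::real) (x::real ^ 'n). c)"
proof
  show "polynomial_invariants \<Gamma> \<phi> \<subseteq> range (\<lambda>(c::real) (x::real ^ 'n). c)"
  proof
    fix p assume "p \<in> polynomial_invariants \<Gamma> \<phi>"
    then have p: "real_polynomial_function p"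
      and inv: "\<And>g x. g \<in> carrier \<Gamma> \<Longrightarrow> p (\<phi> g x) = p x"
      by (auto simp: polynomial_invariants_def)
    have "continuous_map euclidean euclidean p"
      using p continuous_on_polymonial_function by (auto simp: real_polynomial_function_eq)
    then have "compact (range p)"
      using compactin_image_invariant[of \<Gamma> euclidean \<phi> euclidean p] assms inv
      by (simp add: continuous_action_def)
    \<comment> \<open>Compactness of the range supplies the bound, and the value at the origin
      serves as the constant.\<close>
    then have "p = (\<lambda>x. p 0)"
      using bounded_real_polynomial_function_constant[OF p] compact_imp_bounded by blast
    then show "p \<in> range (\<lambda>(c::real) (x::real ^ 'n). c)" by blast
  qed
  show "range (\<lambda>(c::real) (x::real ^ 'n). c) \<subseteq> polynomial_invariants \<Gamma> \<phi>"
    by (auto simp: polynomial_invariants_def intro: real_polynomial_function.intros(2))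
qed

end
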